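(* Fix $0<\alpha<1$ and let $\mathcal{G}_\alpha=(\Pi_m)_{m\ge0}$ be the uniformly stable Galerkin hierarchy on $\mathcal{H}_\alpha$ described in the context. There exists $U\in\mathcal{H}_\alpha$ such that $$\sum_{m=0}^{\infty}\|\Pi_{m+1}U-\Pi_mU\|^2=\infty.$$ In particular, $\mathfrak{C}_{\mathcal{G}_\alpha}(\infty)=\infty$.
   Context: Let $\mathbb{T}=\mathbb{R}/\mathbb{Z}$ be represented by $(-\tfrac12,\tfrac12]$. For $0<\alpha<1$ let $w_\alpha(t)=|t|^\alpha$ and $H_\alpha=L^2(\mathbb{T},w_\alpha(t)\,dt;\mathbb{R})$. Let $(x_n)_{n\ge1}$ be the real trigonometric system $x_1=1$, $x_{2k}=\sqrt2\cos(2\pi kt)$, $x_{2k+1}=\sqrt2\sin(2\pi kt)$ ($k\ge1$), and $z_n=w_\alpha^{-1}x_n$. Both $(x_n)$ and $(z_n)$ are Schauder bases of $H_\alpha$. Let $\mathcal{H}_\alpha=H_\alpha\oplus H_\alpha$ (Hilbert direct sum), and $$f_{2n-1}=2^{-1/2}(x_n,z_n),\qquad f_{2n}=2^{-1/2}(x_n,-z_n)\qquad(n\ge1).$$ $(f_j)_{j\ge1}$ is a Schauder basis of $\mathcal{H}_\alpha$. Let $X_0=\{0\}$, $X_m=\operatorname{span}\{f_1,\dots,f_m\}$, $\Pi_0=0$, and let $\Pi_m:\mathcal{H}_\alpha\to X_m$ be the coordinate partial-sum projection of this basis ($m\ge1$); $\sup_m\|\Pi_m\|<\infty$. Let $J(u,v)=(v,u)$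 on $\mathcal{H}_\alpha$, so $J=J^*=J^{-1}$. With respect to the bilinear form $a(U,V)=(JU,V)_{\mathcal{H}_\alpha}$, $\Pi_m$ is the Galerkin projection onto $X_m$, and the hierarchy is uniformly stable: $$\inf_{m\ge1}\ \inf_{0\ne U_m\in X_m}\ \sup_{0\ne V_m\in X_m}\frac{|(JU_m,V_m)|}{\|U_m\|\|V_m\|}>0.$$ The full general quasi-orthogonality constant is $\mathfrak{C}_{\mathcal{G}_\alpha}(\infty):=\sup_{N\ge1}\mathfrak{C}_{\mathcal{G}_\alpha}(N)\in[0,\infty]$, where $$\mathfrak{C}_{\mathcal{G}_\alpha}(N):=\sup_{\ell\ge0}\ \sup_{\substack{x\in\mathcal{H}_\alpha\\(I-\Pi_\ell)x\ne0}}\frac{\sum_{k=\ell}^{\ell+N-1}\|(\Pi_{k+1}-\Pi_k)x\|^2}{\|(I-\Pi_\ell)x\|^2}.$$ *)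

theory Defs
  imports "HOL-Analysis.Analysis"
begin

text \<open>
  The torus is represented by \<open>(-1/2, 1/2]\<close>.  Elements of the weighted space
  \<open>L\<^sup>2(T, |t|\<^sup>\<alpha> dt)\<close> are represented by functions rather than by classes modulo
  a.e. equality, so \<open>wL2_norm\<close> is a seminorm on representatives, and a
  representative stands for the zero vector iff its norm is 0.
\<close>

definition wmeasure :: "real \<Rightarrow> real measure" where
  "wmeasure \<alpha> = density (restrict_space lborel {-1/2<..1/2}) (\<lambda>t. ennreal (\<bar>t\<bar> powr \<alpha>))"

definition wL2 :: "real \<Rightarrow> (real \<Rightarrow> real) set" where
  "wL2 \<alpha> = {u. u \<in> borel_measurable (wmeasure \<alpha>) \<and> integrable (wmeasure \<alpha>) (\<lambda>t. (u t)\<^sup>2)}"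

definition wL2_norm :: "real \<Rightarrow> (real \<Rightarrow> real) \<Rightarrow> real" where
  "wL2_norm \<alpha> u = sqrt (\<integral>t. (u t)\<^sup>2 \<partial>wmeasure \<alpha>)"

type_synonym fpair = "(real \<Rightarrow> real) \<times> (real \<Rightarrow> real)"

definition HH :: "real \<Rightarrow> fpair set" where
  "HH \<alpha> = wL2 \<alpha> \<times> wL2 \<alpha>"

definition HH_norm :: "real \<Rightarrow> fpair \<Rightarrow> real" where
  "HH_norm \<alpha> U = sqrt ((wL2_norm \<alpha> (fst U))\<^sup>2 + (wL2_norm \<alpha> (snd U))\<^sup>2)"

text \<open>The families below are indexed from 1; their values at index 0 are never used.\<close>

definition trig :: "nat \<Rightarrow> real \<Rightarrow> real" where
  "trig n t =
    (if n = 1 then 1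
     else if even n then sqrt 2 * cos (2 * pi * real (n div 2) * t)
     else sqrt 2 * sin (2 * pi * real (n div 2) * t))"

definition dual_trig :: "real \<Rightarrow> nat \<Rightarrow> real \<Rightarrow> real" where
  "dual_trig \<alpha> n t = trig n t / \<bar>t\<bar> powr \<alpha>"

text \<open>Both \<open>j = 2n - 1\<close> and \<open>j = 2n\<close> give \<open>n = (j + 1) div 2\<close>.\<close>

definition fbasis :: "real \<Rightarrow> nat \<Rightarrow> fpair" where
  "fbasis \<alpha> j =
    (let n = (j + 1) div 2
     in (\<lambda>t. trig n t / sqrt 2,
         \<lambda>t. (if odd j then 1 else - 1) * dual_trig \<alpha> n t / sqrt 2))"

definition fcomb :: "real \<Rightarrow> (nat \<Rightarrow> real) \<Rightarrow> nat \<Rightarrow> fpair" where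
  "fcomb \<alpha> c m =
    (\<lambda>t. \<Sum>j=1..m. c j * fst (fbasis \<alpha> j) t,
     \<lambda>t. \<Sum>j=1..m. c j * snd (fbasis \<alpha> j) t)"

text \<open>
  Schauder coordinates: the unique coefficients of the norm-convergent expansion
  \<open>U = (\<Sum>j\<ge>1. c j f\<^sub>j)\<close>.  The condition \<open>c 0 = 0\<close> only fixes the
  unused entry, without which the coefficient sequence would not be unique.
  For \<open>0 < \<alpha> < 1\<close> the family \<open>(f\<^sub>j)\<close> is a Schauder basis, so
  every element of \<open>HH \<alpha>\<close> has such an expansion; this is not proved here, and the
  description is unspecified for an element without one.
\<close>

definition fcoords :: "real \<Rightarrow> fpair \<Rightarrow> nat \<Rightarrow> real" where
  "fcoords \<alpha> U =
    (THE c. c 0 = 0 \<and> (\<lambda>m. HH_norm \<alpha> (U - fcomb \<alpha> c m)) \<longlonglongrightarrow> 0)"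

definition fproj :: "real \<Rightarrow> nat \<Rightarrow> fpair \<Rightarrow> fpair" where
  "fproj \<alpha> m U = fcomb \<alpha> (fcoords \<alpha> U) m"

definition quasi_orth_const :: "real \<Rightarrow> nat \<Rightarrow> ennreal" where
  "quasi_orth_const \<alpha> N =
    (SUP l. SUP U \<in> {U \<in> HH \<alpha>. HH_norm \<alpha> (U - fproj \<alpha> l U) \<noteq> 0}.
       ennreal ((\<Sum>k=l..<l + N. (HH_norm \<alpha> (fproj \<alpha> (k + 1) U - fproj \<alpha> k U))\<^sup>2)
                / (HH_norm \<alpha> (U - fproj \<alpha> l U))\<^sup>2))"

definition full_quasi_orth_const :: "real \<Rightarrow> ennreal" where
  "full_quasi_orth_const \<alpha> = (SUP N \<in> {1..}. quasi_orth_const \<alpha> N)"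

end

theory Submission
  imports Defs
begin

text \<open>
  The weight \<open>\<bar>t\<bar>\<^sup>\<alpha>\<close> vanishes at the origin, so the weighted space is strictly larger than
  \<open>L\<^sup>2\<close>: it contains functions that behave like \<open>\<bar>t\<bar>\<^sup>-\<^sup>1\<^sup>/\<^sup>2\<close> at 0, and the Fourier
  coefficients of such a function are not square summable.  A concrete one is
  \<open>u(t) = (\<Sum>k\<ge>1. cos (2 \<pi> k t) / \<surd>k)\<close>, and the diverging element is \<open>U = (u, 0)\<close>.

  The pair \<open>(x\<^sub>n, 0)\<close> is \<open>(f\<^sub>2\<^sub>n\<^sub>-\<^sub>1 + f\<^sub>2\<^sub>n) / \<surd>2\<close>, so both coordinates of \<open>U\<close> with
  indices \<open>4k - 1\<close> and \<open>4k\<close> equal \<open>1 / (2 \<surd>k)\<close> and all others vanish.  The increment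
  \<open>\<Pi>\<^sub>j U - \<Pi>\<^sub>j\<^sub>-\<^sub>1 U\<close> is the \<open>j\<close>-th coordinate times \<open>f\<^sub>j\<close>, and \<open>f\<^sub>j\<close> has norm at least 1,
  because \<open>1 = (x\<^sub>n, z\<^sub>n)\<close> is at most \<open>(\<parallel>x\<^sub>n\<parallel>\<^sup>2 + \<parallel>z\<^sub>n\<parallel>\<^sup>2) / 2 = \<parallel>f\<^sub>j\<parallel>\<^sup>2\<close>
  (\<open>HH_norm_fbasis_ge_1\<close>).  The squared increments therefore dominate a multiple of the harmonic
  series (\<open>witness_increments_ge\<close>).  Taking \<open>\<ell> = 0\<close> and this \<open>U\<close> in the quasi-orthogonality
  constant makes it infinite.

  What has to be justified is that these numbers are the Schauder coordinates of \<open>U\<close>.  Since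
  only this one element matters, the basis property of the whole system is replaced by two facts.
  Uniqueness (\<open>fcoords_eqI\<close>) holds for every element: the systems \<open>x\<^sub>n\<close> and \<open>z\<^sub>n\<close> are
  biorthogonal in the weighted inner product, so coefficients of a norm-convergent expansion are
  recovered by continuous functionals.  Existence (\<open>witness_expansion\<close>) follows by dominated
  convergence: Abel summation shows that the cosine partial sums converge away from 0 and are
  bounded by \<open>3 \<bar>t\<bar>\<^sup>-\<^sup>1\<^sup>/\<^sup>2\<close>, whose square is integrable against \<open>\<bar>t\<bar>\<^sup>\<alpha>\<close>
  (\<open>cos_sum_dominated\<close>).
\<close>

section \<open>The weighted space\<close>

lemma integrable_abs_powr:
  fixes p :: real
  assumes "p > -1"
  shows "integrable lborel (\<lambda>t. indicator {-1/2<..1/2} t *\<^sub>R \<bar>t\<bar> powr p)"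
proof -
  have meas: "(\<lambda>t::real. indicator {0<..1/2} t *\<^sub>R t powr p) \<in> borel_measurable borel"
    by measurable
  have "(\<lambda>t::real. t powr p) absolutely_integrable_on {0<..1/2}"
    by (intro nonnegative_absolutely_integrable_1 integrable_on_powr_from_0' assms) auto
  then have pos: "integrable lborel (\<lambda>t::real. indicator {0<..1/2} t *\<^sub>R t powr p)"
    unfolding set_integrable_def
    by (subst (asm) integrable_completion) (use meas in auto)
  have neg: "integrable lborel (\<lambda>t::real. indicator {0<..1/2} (- t) *\<^sub>R (- t) powr p)"
    using lborel_integrable_real_affine_iff[of "-1" "\<lambda>t. indicator {0<..1/2} t *\<^sub>R t powr p" 0] pos
    by simp
  show ?thesis
    by (rule Bochner_Integration.integrable_bound[OF Bochner_Integration.integrable_add[OF pos neg]])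
       (auto simp: indicator_def)
qed

lemma integrable_wmeasure:
  fixes f :: "real \<Rightarrow> real"
  assumes [measurable]: "f \<in> borel_measurable borel"
  shows "integrable (wmeasure \<alpha>) f \<longleftrightarrow>
         integrable lborel (\<lambda>t. indicator {-1/2<..1/2} t *\<^sub>R (\<bar>t\<bar> powr \<alpha> * f t))"
proof -
  have "(\<lambda>t. \<bar>t\<bar> powr \<alpha>) \<in> borel_measurable (restrict_space lborel {-1/2<..1/2})"
       "f \<in> borel_measurable (restrict_space lborel {-1/2<..1/2})"
    by (auto intro!: measurable_restrict_space1)
  then show ?thesis
    unfolding wmeasure_def
    by (subst integrable_density) (auto simp: integrable_restrict_space)
qed

lemma integral_wmeasure:
  fixes f :: "real \<Rightarrow> real"
  assumes [measurable]: "f \<in> borel_measurable borel"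
  shows "(\<integral>t. f t \<partial>wmeasure \<alpha>) =
         (\<integral>t. indicator {-1/2<..1/2} t *\<^sub>R (\<bar>t\<bar> powr \<alpha> * f t) \<partial>lborel)"
proof -
  have "(\<lambda>t. \<bar>t\<bar> powr \<alpha>) \<in> borel_measurable (restrict_space lborel {-1/2<..1/2})"
       "f \<in> borel_measurable (restrict_space lborel {-1/2<..1/2})"
    by (auto intro!: measurable_restrict_space1)
  then show ?thesis
    unfolding wmeasure_def
    by (subst integral_density) (auto simp: integral_restrict_space)
qed

lemma borel_measurable_wmeasure:
  "f \<in> borel_measurable borel \<Longrightarrow> f \<in> borel_measurable (wmeasure \<alpha>)"
  unfolding wmeasure_def by (auto intro!: measurable_restrict_space1)

lemma AE_wmeasure: "AE t in wmeasure \<alpha>. t \<noteq> 0 \<and> \<bar>t\<bar> \<le> 1/2"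
proof -
  have "AE t in lborel. (t::real) \<noteq> 0" by (rule AE_lborel_singleton)
  then have "AE t in restrict_space lborel {-1/2<..1/2}. (t::real) \<noteq> 0 \<and> \<bar>t\<bar> \<le> 1/2"
    by (subst AE_restrict_space_iff) auto
  then show ?thesis
    unfolding wmeasure_def
    by (subst AE_density) (auto intro!: measurable_restrict_space1 elim!: AE_mp)
qed

lemma integrable_wmeasure_powr:
  assumes "p + \<alpha> > -1"
  shows "integrable (wmeasure \<alpha>) (\<lambda>t. \<bar>t\<bar> powr p)"
proof (subst integrable_wmeasure)
  have "\<bar>t\<bar> powr \<alpha> * \<bar>t\<bar> powr p = \<bar>t\<bar> powr (p + \<alpha>)" for t :: real
    by (simp add: powr_add mult.commute)
  then show "integrable lborel (\<lambda>t. indicator {-1/2<..1/2} t *\<^sub>R (\<bar>t\<bar> powr \<alpha> * \<bar>t\<bar> powr p))"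
    using integrable_abs_powr[OF assms] by simp
qed simp

text \<open>
  Membership in the weighted space is only ever checked by comparison with a power of \<open>\<bar>t\<bar>\<close>.
  The condition on the exponent says that the squared power times the weight is integrable at 0.
\<close>

lemma wL2_bound:
  assumes "2 * p + \<alpha> > -1" and f: "f \<in> borel_measurable borel"
    and bound: "\<And>t. t \<noteq> 0 \<Longrightarrow> \<bar>t\<bar> \<le> 1/2 \<Longrightarrow> \<bar>f t\<bar> \<le> C * \<bar>t\<bar> powr p"
  shows "f \<in> wL2 \<alpha>"
proof -
  have "integrable (wmeasure \<alpha>) (\<lambda>t. (f t)\<^sup>2)"
  proof (rule Bochner_Integration.integrable_bound)
    show "integrable (wmeasure \<alpha>) (\<lambda>t. C\<^sup>2 * \<bar>t\<bar> powr (2 * p))"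
      by (intro integrable_mult_right integrable_wmeasure_powr assms)
    show "(\<lambda>t. (f t)\<^sup>2) \<in> borel_measurable (wmeasure \<alpha>)"
      using f by (intro borel_measurable_wmeasure) measurable
    show "AE t in wmeasure \<alpha>. norm ((f t)\<^sup>2) \<le> norm (C\<^sup>2 * \<bar>t\<bar> powr (2 * p))"
      using AE_wmeasure
    proof eventually_elim
      case (elim t)
      then have "\<bar>f t\<bar>\<^sup>2 \<le> (C * \<bar>t\<bar> powr p)\<^sup>2"
        by (intro power_mono bound) auto
      also have "\<dots> = C\<^sup>2 * \<bar>t\<bar> powr (2 * p)"
        by (simp add: power_mult_distrib powr_add[symmetric] power2_eq_square)
      finally show ?case by simp
    qed
  qed
  then show ?thesis
    using f by (simp add: wL2_def borel_measurable_wmeasure)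
qed

lemma wL2_mult_integrable:
  assumes "f \<in> wL2 \<alpha>" "g \<in> wL2 \<alpha>"
  shows "integrable (wmeasure \<alpha>) (\<lambda>t. f t * g t)"
proof (rule Bochner_Integration.integrable_bound)
  show "integrable (wmeasure \<alpha>) (\<lambda>t. (f t)\<^sup>2 + (g t)\<^sup>2)"
    using assms by (auto simp: wL2_def)
  show "(\<lambda>t. f t * g t) \<in> borel_measurable (wmeasure \<alpha>)"
    using assms by (auto simp: wL2_def)
  have "\<bar>x * y\<bar> \<le> x\<^sup>2 + y\<^sup>2" for x y :: real
  proof -
    have "2 * \<bar>x * y\<bar> \<le> x\<^sup>2 + y\<^sup>2"
      using sum_squares_bound[of "\<bar>x\<bar>" "\<bar>y\<bar>"] by (simp add: abs_mult mult.assoc)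
    then show ?thesis using abs_ge_zero[of "x * y"] by linarith
  qed
  then show "AE t in wmeasure \<alpha>. norm (f t * g t) \<le> norm ((f t)\<^sup>2 + (g t)\<^sup>2)"
    by (intro AE_I2) (simp add: abs_of_nonneg)
qed

definition wL2_inner :: "real \<Rightarrow> (real \<Rightarrow> real) \<Rightarrow> (real \<Rightarrow> real) \<Rightarrow> real" where
  "wL2_inner \<alpha> f g = (\<integral>t. f t * g t \<partial>wmeasure \<alpha>)"

lemma wL2_scale: "f \<in> wL2 \<alpha> \<Longrightarrow> (\<lambda>t. c * f t) \<in> wL2 \<alpha>"
  by (auto simp: wL2_def power_mult_distrib)

lemma wL2_add:
  assumes "f \<in> wL2 \<alpha>" "g \<in> wL2 \<alpha>"
  shows "(\<lambda>t. f t + g t) \<in> wL2 \<alpha>"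
  using assms wL2_mult_integrable[OF assms]
  by (auto simp: wL2_def power2_sum mult.assoc)

lemma wL2_diff:
  assumes "f \<in> wL2 \<alpha>" "g \<in> wL2 \<alpha>"
  shows "(\<lambda>t. f t - g t) \<in> wL2 \<alpha>"
  using wL2_add[OF assms(1) wL2_scale[OF assms(2), of "-1"]] by simp

lemma wL2_sum:
  assumes "\<And>i. i \<in> A \<Longrightarrow> f i \<in> wL2 \<alpha>"
  shows "(\<lambda>t. \<Sum>i\<in>A. f i t) \<in> wL2 \<alpha>"
  using assms
proof (induction A rule: infinite_finite_induct)
  case (insert i A)
  then show ?case using wL2_add[of "f i" \<alpha> "\<lambda>t. \<Sum>i\<in>A. f i t"] by simp
qed (auto simp: wL2_def)

lemma wL2_norm_power2: "(wL2_norm \<alpha> f)\<^sup>2 = (\<integral>t. (f t)\<^sup>2 \<partial>wmeasure \<alpha>)"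
  by (simp add: wL2_norm_def)

text \<open>
  Functions here are representatives with a seminorm, so the inequality cannot be read off an
  inner product type; it comes from the nonnegative quadratic \<open>r \<mapsto> \<parallel>f - r g\<parallel>\<^sup>2\<close>.
\<close>

lemma wL2_inner_Cauchy_Schwarz:
  assumes f: "f \<in> wL2 \<alpha>" and g: "g \<in> wL2 \<alpha>"
  shows "\<bar>wL2_inner \<alpha> f g\<bar> \<le> wL2_norm \<alpha> f * wL2_norm \<alpha> g"
proof -
  define A B C where "A = (wL2_norm \<alpha> f)\<^sup>2" and "B = wL2_inner \<alpha> f g" and "C = (wL2_norm \<alpha> g)\<^sup>2"
  have quad: "0 \<le> A - 2 * r * B + r\<^sup>2 * C" for r
  proof -
    have "0 \<le> (\<integral>t. (f t - r * g t)\<^sup>2 \<partial>wmeasure \<alpha>)" by simp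
    also have "\<dots> = (\<integral>t. (f t)\<^sup>2 - 2 * r * (f t * g t) + r\<^sup>2 * (g t)\<^sup>2 \<partial>wmeasure \<alpha>)"
      by (simp add: power2_diff power_mult_distrib algebra_simps)
    also have "\<dots> = A - 2 * r * B + r\<^sup>2 * C"
      using f g wL2_mult_integrable[OF f g]
      by (simp add: A_def B_def C_def wL2_norm_power2 wL2_inner_def wL2_def)
    finally show ?thesis .
  qed
  have C0: "C \<ge> 0" by (simp add: C_def)
  have "B\<^sup>2 \<le> A * C"
  proof (cases "C = 0")
    case True
    have "B = 0"
    \<comment> \<open>The quadratic is affine in this case; the chosen point makes it equal to \<open>-1\<close>.\<close>
    proof (rule ccontr)
      assume "B \<noteq> 0"
      then show False using quad[of "(A + 1) / (2 * B)"] True by (simp add: field_simps)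
    qed
    then show ?thesis using True by simp
  next
    case False
    then have "C > 0" using C0 by simp
    then show ?thesis using quad[of "B / C"] by (simp add: field_simps power2_eq_square)
  qed
  then have "\<bar>B\<bar>\<^sup>2 \<le> (wL2_norm \<alpha> f * wL2_norm \<alpha> g)\<^sup>2"
    by (simp add: A_def C_def power_mult_distrib)
  then show ?thesis
    unfolding B_def by (rule power2_le_imp_le) (simp add: wL2_norm_def)
qed

text \<open>
  Convergence of both components of the expansion is obtained from this form of dominated
  convergence, with a different exponent for each component.
\<close>

lemma wL2_norm_dominated:
  assumes "2 * p + \<alpha> > -1" and f: "f \<in> borel_measurable borel"
    and fm: "\<And>m. fm m \<in> borel_measurable borel"
    and bound: "\<And>m t. t \<noteq> 0 \<Longrightarrow> \<bar>t\<bar> \<le> 1/2 \<Longrightarrow> \<bar>f t - fm m t\<bar> \<le> C * \<bar>t\<bar> powr p"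
    and lim: "\<And>t. t \<noteq> 0 \<Longrightarrow> \<bar>t\<bar> \<le> 1/2 \<Longrightarrow> (\<lambda>m. fm m t) \<longlonglongrightarrow> f t"
  shows "(\<lambda>m. wL2_norm \<alpha> (\<lambda>t. f t - fm m t)) \<longlonglongrightarrow> 0"
proof -
  have "(\<lambda>m. \<integral>t. (f t - fm m t)\<^sup>2 \<partial>wmeasure \<alpha>) \<longlonglongrightarrow> (\<integral>t. 0 \<partial>wmeasure \<alpha>)"
  proof (rule integral_dominated_convergence)
    show "integrable (wmeasure \<alpha>) (\<lambda>t. C\<^sup>2 * \<bar>t\<bar> powr (2 * p))"
      by (intro integrable_mult_right integrable_wmeasure_powr assms)
    show "(\<lambda>t. (f t - fm m t)\<^sup>2) \<in> borel_measurable (wmeasure \<alpha>)" for m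
      using f fm by (intro borel_measurable_wmeasure) measurable
    show "AE t in wmeasure \<alpha>. (\<lambda>m. (f t - fm m t)\<^sup>2) \<longlonglongrightarrow> 0"
      using AE_wmeasure
    proof eventually_elim
      case (elim t)
      then have "(\<lambda>m. (f t - fm m t)\<^sup>2) \<longlonglongrightarrow> (f t - f t)\<^sup>2"
        by (intro tendsto_intros lim) auto
      then show ?case by simp
    qed
    show "AE t in wmeasure \<alpha>. norm ((f t - fm m t)\<^sup>2) \<le> C\<^sup>2 * \<bar>t\<bar> powr (2 * p)" for m
      using AE_wmeasure
    proof eventually_elim
      case (elim t)
      then have "\<bar>f t - fm m t\<bar>\<^sup>2 \<le> (C * \<bar>t\<bar> powr p)\<^sup>2"
        by (intro power_mono bound) auto
      also have "\<dots> = C\<^sup>2 * \<bar>t\<bar> powr (2 * p)"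
        by (simp add: power_mult_distrib powr_add[symmetric] power2_eq_square)
      finally show ?case by simp
    qed
  qed simp
  then show ?thesis
    unfolding wL2_norm_def by (auto intro!: tendsto_eq_intros)
qed

section \<open>Biorthogonality and uniqueness of coordinates\<close>

lemma integral_cos_period:
  fixes j :: int
  shows "((\<lambda>t. cos (2 * pi * of_int j * t - \<phi>)) has_integral (if j = 0 then cos \<phi> else 0)) {-1/2..1/2}"
proof (cases "j = 0")
  case True
  then show ?thesis using has_integral_const_real[of "cos \<phi>" "-1/2" "1/2"] by simp
next
  case False
  define F where "F t = sin (2 * pi * of_int j * t - \<phi>) / (2 * pi * of_int j)" for t :: real
  have "((\<lambda>t. cos (2 * pi * of_int j * t - \<phi>)) has_integral (F (1/2) - F (-1/2))) {-1/2..1/2}"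
    unfolding F_def using False
    by (intro fundamental_theorem_of_calculus)
       (auto intro!: derivative_eq_intros simp: has_real_derivative_iff_has_vector_derivative[symmetric])
  moreover have "F (1/2) = F (-1/2)"
  proof -
    have "sin (pi * of_int j - \<phi>) = sin ((- pi * of_int j - \<phi>) + 2 * pi * of_int j)"
      by (simp add: algebra_simps)
    also have "\<dots> = sin (- pi * of_int j - \<phi>)"
      by (simp only: sin_add sin_int_2pin cos_int_2pin mult_zero_right mult_1_right add_0_right)
    finally show ?thesis by (simp add: F_def)
  qed
  ultimately show ?thesis using False by simp
qed

text \<open>
  Writing sines as phase-shifted cosines lets a single product formula cover all the cases of
  the orthogonality relations.
\<close>

lemma trig_eq_scaled_cos:
  "trig n t = (if n = 1 then 1 else sqrt 2) *
     cos (2 * pi * of_int (int (n div 2)) * t - (if even n \<or> n = 1 then 0 else pi / 2))"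
  by (auto simp: trig_def cos_diff)

lemma trig_orthonormal:
  assumes "m \<ge> 1" "n \<ge> 1"
  shows "((\<lambda>t. trig m t * trig n t) has_integral (if m = n then 1 else 0)) {-1/2..1/2}"
proof -
  define s where "s n = (if n = 1 then 1 else sqrt 2)" for n :: nat
  define \<phi> where "\<phi> n = (if even n \<or> n = 1 then 0 else pi / 2)" for n :: nat
  define j where "j n = int (n div 2)" for n :: nat
  have eq: "trig m t * trig n t = s m * s n / 2 *
      (cos (2 * pi * of_int (j m - j n) * t - (\<phi> m - \<phi> n)) +
       cos (2 * pi * of_int (j m + j n) * t - (\<phi> m + \<phi> n)))" for t
  proof -
    have "trig m t * trig n t = s m * s n *
       (cos (2 * pi * of_int (j m) * t - \<phi> m) * cos (2 * pi * of_int (j n) * t - \<phi> n))"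
      unfolding trig_eq_scaled_cos s_def j_def \<phi>_def by simp
    also have "\<dots> = s m * s n *
       ((cos ((2 * pi * of_int (j m) * t - \<phi> m) - (2 * pi * of_int (j n) * t - \<phi> n)) +
         cos ((2 * pi * of_int (j m) * t - \<phi> m) + (2 * pi * of_int (j n) * t - \<phi> n))) / 2)"
      unfolding cos_times_cos ..
    finally show ?thesis by (simp add: algebra_simps)
  qed
  let ?I = "s m * s n / 2 * ((if j m - j n = 0 then cos (\<phi> m - \<phi> n) else 0) +
                             (if j m + j n = 0 then cos (\<phi> m + \<phi> n) else 0))"
  have "((\<lambda>t. trig m t * trig n t) has_integral ?I) {-1/2..1/2}"
    unfolding eq by (intro has_integral_mult_right has_integral_add integral_cos_period)
  moreover have "?I = (if m = n then 1 else 0)"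
  proof (cases "m = n")
    case True
    show ?thesis
    proof (cases "n = 1")
      case False
      then have "j n \<noteq> 0" using assms unfolding j_def by presburger
      then show ?thesis using \<open>m = n\<close> False by (simp add: s_def)
    qed (use \<open>m = n\<close> in \<open>simp add: s_def \<phi>_def j_def\<close>)
  next
    case False
    show ?thesis
    proof (cases "j m = j n")
      case True
      then have "m div 2 = n div 2" by (simp add: j_def)
      moreover from this have "m div 2 \<noteq> 0" using False assms by presburger
      moreover have "even m \<longleftrightarrow> odd n" using False \<open>m div 2 = n div 2\<close> by presburger
      ultimately show ?thesis using False by (auto simp: \<phi>_def j_def)
    next
      case False
      then show ?thesis using \<open>m \<noteq> n\<close> by (auto simp: j_def)
    qed
  qed
  ultimately show ?thesis by (simp only:)
qed

lemma trig_measurable [measurable]: "trig n \<in> borel_measurable borel"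
  unfolding trig_def by measurable

lemma dual_trig_measurable [measurable]: "dual_trig \<alpha> n \<in> borel_measurable borel"
  unfolding dual_trig_def by measurable

lemma abs_trig_le: "\<bar>trig n t\<bar> \<le> sqrt 2"
proof -
  have "sqrt 2 * \<bar>x\<bar> \<le> sqrt 2" if "\<bar>x\<bar> \<le> 1" for x :: real
    using mult_left_mono[OF that, of "sqrt 2"] by simp
  then show ?thesis by (auto simp: trig_def abs_mult)
qed

text \<open>
  The weight cancels the factor \<open>\<bar>t\<bar>\<^sup>-\<^sup>\<alpha>\<close> in the dual function away from the origin, which
  reduces the claim to ordinary orthonormality.
\<close>

lemma wL2_inner_trig_dual_trig:
  assumes "m \<ge> 1" "n \<ge> 1"
  shows "wL2_inner \<alpha> (trig m) (dual_trig \<alpha> n) = (if m = n then 1 else 0)"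
proof -
  have cont: "continuous_on {-1/2..1/2} (\<lambda>t. trig m t * trig n t)"
    unfolding trig_eq_scaled_cos by (intro continuous_intros)
  have int: "set_integrable lborel {-1/2..1/2} (\<lambda>t. trig m t * trig n t)"
    using cont by (rule borel_integrable_atLeastAtMost')
  have "wL2_inner \<alpha> (trig m) (dual_trig \<alpha> n) =
        (\<integral>t. indicator {-1/2<..1/2} t *\<^sub>R (\<bar>t\<bar> powr \<alpha> * (trig m t * dual_trig \<alpha> n t)) \<partial>lborel)"
    unfolding wL2_inner_def by (rule integral_wmeasure) measurable
  also have "\<dots> = (\<integral>t. indicator {-1/2..1/2} t *\<^sub>R (trig m t * trig n t) \<partial>lborel)"
  proof (rule integral_cong_AE)
    show "AE t in lborel. indicator {-1/2<..1/2} t *\<^sub>R (\<bar>t\<bar> powr \<alpha> * (trig m t * dual_trig \<alpha> n t)) =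
            indicator {-1/2..1/2} t *\<^sub>R (trig m t * trig n t)"
      using AE_lborel_singleton[of "0::real"] AE_lborel_singleton[of "-1/2::real"]
      by eventually_elim (auto simp: indicator_def dual_trig_def)
  qed measurable
  also have "\<dots> = integral {-1/2..1/2} (\<lambda>t. trig m t * trig n t)"
    using set_borel_integral_eq_integral(2)[OF int] by (simp add: set_lebesgue_integral_def)
  also have "\<dots> = (if m = n then 1 else 0)"
    by (rule integral_unique[OF trig_orthonormal[OF assms]])
  finally show ?thesis .
qed

lemma trig_in_wL2:
  assumes "0 < \<alpha>" shows "trig n \<in> wL2 \<alpha>"
  by (rule wL2_bound[where p = 0 and C = "sqrt 2"]) (use assms abs_trig_le in auto)

lemma dual_trig_in_wL2:
  assumes "\<alpha> < 1" shows "dual_trig \<alpha> n \<in> wL2 \<alpha>"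
  by (rule wL2_bound[where p = "-\<alpha>" and C = "sqrt 2"])
     (use assms abs_trig_le in \<open>auto simp: dual_trig_def powr_minus divide_simps\<close>)

lemma wL2_inner_commute: "wL2_inner \<alpha> f g = wL2_inner \<alpha> g f"
  by (simp add: wL2_inner_def mult.commute)

lemma wL2_inner_diff_left:
  assumes "f \<in> wL2 \<alpha>" "g \<in> wL2 \<alpha>" "h \<in> wL2 \<alpha>"
  shows "wL2_inner \<alpha> (\<lambda>t. f t - g t) h = wL2_inner \<alpha> f h - wL2_inner \<alpha> g h"
  using wL2_mult_integrable[OF assms(1,3)] wL2_mult_integrable[OF assms(2,3)]
  by (simp add: wL2_inner_def left_diff_distrib)

lemma wL2_inner_sum_left:
  assumes "\<And>i. i \<in> A \<Longrightarrow> f i \<in> wL2 \<alpha>" "h \<in> wL2 \<alpha>"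
  shows "wL2_inner \<alpha> (\<lambda>t. \<Sum>i\<in>A. c i * f i t) h = (\<Sum>i\<in>A. c i * wL2_inner \<alpha> (f i) h)"
  using assms wL2_mult_integrable[OF _ assms(2)]
  by (simp add: wL2_inner_def sum_distrib_right mult.assoc)

lemma fcomb_fst: "fst (fcomb \<alpha> c m) = (\<lambda>t. \<Sum>j=1..m. (c j / sqrt 2) * trig ((j + 1) div 2) t)"
  by (simp add: fcomb_def fbasis_def Let_def)

lemma fcomb_snd:
  "snd (fcomb \<alpha> c m) =
     (\<lambda>t. \<Sum>j=1..m. ((if odd j then 1 else - 1) * c j / sqrt 2) * dual_trig \<alpha> ((j + 1) div 2) t)"
  by (simp add: fcomb_def fbasis_def Let_def if_distrib if_distribR cong: if_cong sum.cong)

text \<open>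
  The indices \<open>2n - 1\<close> and \<open>2n\<close> are the two that share the trigonometric function number \<open>n\<close>.
\<close>

lemma sum_over_pair:
  fixes g :: "nat \<Rightarrow> real"
  assumes "n \<ge> 1" "m \<ge> 2 * n"
  shows "(\<Sum>j=1..m. g j * (if (j + 1) div 2 = n then 1 else 0)) = g (2 * n - 1) + g (2 * n)"
proof -
  have "(\<Sum>j=1..m. g j * (if (j + 1) div 2 = n then 1 else 0)) =
        (\<Sum>j\<in>{2 * n - 1, 2 * n}. g j * (if (j + 1) div 2 = n then 1 else 0))"
  proof (intro sum.mono_neutral_right ballI)
    fix j assume "j \<in> {1..m} - {2 * n - 1, 2 * n}"
    then have "(j + 1) div 2 \<noteq> n" using assms by simp presburger
    then show "g j * (if (j + 1) div 2 = n then 1 else 0) = 0" by simp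
  qed (use assms in auto)
  then show ?thesis using assms by simp
qed

text \<open>
  Pairing the first component with \<open>z\<^sub>n\<close> and the second with \<open>x\<^sub>n\<close> is continuous in norm, and on
  the partial sums these pairings are constant from index \<open>2n\<close> on.  They give the sum and the
  difference of the two coefficients that belong to \<open>n\<close>.
\<close>

lemma HH_coords:
  assumes \<alpha>: "0 < \<alpha>" "\<alpha> < 1" and U: "U \<in> HH \<alpha>"
    and lim: "(\<lambda>m. HH_norm \<alpha> (U - fcomb \<alpha> c m)) \<longlonglongrightarrow> 0" and n: "n \<ge> 1"
  shows "c (2 * n - 1) + c (2 * n) = sqrt 2 * wL2_inner \<alpha> (fst U) (dual_trig \<alpha> n)"
    and "c (2 * n - 1) - c (2 * n) = sqrt 2 * wL2_inner \<alpha> (snd U) (trig n)"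
proof -
  have biorth: "wL2_inner \<alpha> (trig ((j + 1) div 2)) (dual_trig \<alpha> n) = (if (j + 1) div 2 = n then 1 else 0)"
    "wL2_inner \<alpha> (dual_trig \<alpha> ((j + 1) div 2)) (trig n) = (if (j + 1) div 2 = n then 1 else 0)"
    if "1 \<le> j" for j
  proof -
    have j: "1 \<le> (j + 1) div 2" using that by simp
    show "wL2_inner \<alpha> (trig ((j + 1) div 2)) (dual_trig \<alpha> n) = (if (j + 1) div 2 = n then 1 else 0)"
      by (rule wL2_inner_trig_dual_trig[OF j n])
    show "wL2_inner \<alpha> (dual_trig \<alpha> ((j + 1) div 2)) (trig n) = (if (j + 1) div 2 = n then 1 else 0)"
      unfolding wL2_inner_commute[of _ "dual_trig _ _"] wL2_inner_trig_dual_trig[OF n j] by (simp only: eq_commute)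
  qed
  note x = trig_in_wL2[OF \<alpha>(1)] and z = dual_trig_in_wL2[OF \<alpha>(2)]
  have U1: "fst U \<in> wL2 \<alpha>" and U2: "snd U \<in> wL2 \<alpha>" using U by (auto simp: HH_def)
  have F1: "fst (fcomb \<alpha> c m) \<in> wL2 \<alpha>" and F2: "snd (fcomb \<alpha> c m) \<in> wL2 \<alpha>" for m
    unfolding fcomb_fst fcomb_snd by (intro wL2_sum wL2_scale x z)+
  have *: "wL2_inner \<alpha> f g = L" if f: "f \<in> wL2 \<alpha>" and g: "g \<in> wL2 \<alpha>" and h: "\<And>m. h m \<in> wL2 \<alpha>"
      and le: "\<And>m. wL2_norm \<alpha> (\<lambda>t. f t - h m t) \<le> HH_norm \<alpha> (U - fcomb \<alpha> c m)"
      and ev: "\<And>m. m \<ge> 2 * n \<Longrightarrow> wL2_inner \<alpha> (h m) g = L" for f g h L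
  proof -
    have "(\<lambda>m. wL2_inner \<alpha> f g - wL2_inner \<alpha> (h m) g) \<longlonglongrightarrow> 0"
    proof (rule Lim_null_comparison)
      show "(\<lambda>m. HH_norm \<alpha> (U - fcomb \<alpha> c m) * wL2_norm \<alpha> g) \<longlonglongrightarrow> 0"
        by (rule tendsto_mult_left_zero[OF lim])
      show "\<forall>\<^sub>F m in sequentially. norm (wL2_inner \<alpha> f g - wL2_inner \<alpha> (h m) g)
              \<le> HH_norm \<alpha> (U - fcomb \<alpha> c m) * wL2_norm \<alpha> g"
      proof (intro always_eventually allI)
        fix m
        have "\<bar>wL2_inner \<alpha> f g - wL2_inner \<alpha> (h m) g\<bar> \<le> wL2_norm \<alpha> (\<lambda>t. f t - h m t) * wL2_norm \<alpha> g"
          using wL2_inner_Cauchy_Schwarz[OF wL2_diff[OF f h] g] by (simp add: wL2_inner_diff_left f g h)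
        also have "\<dots> \<le> HH_norm \<alpha> (U - fcomb \<alpha> c m) * wL2_norm \<alpha> g"
          by (intro mult_right_mono le) (simp add: wL2_norm_def)
        finally show "norm (wL2_inner \<alpha> f g - wL2_inner \<alpha> (h m) g) \<le> HH_norm \<alpha> (U - fcomb \<alpha> c m) * wL2_norm \<alpha> g"
          by simp
      qed
    qed
    moreover have "(\<lambda>m. wL2_inner \<alpha> f g - wL2_inner \<alpha> (h m) g) \<longlonglongrightarrow> wL2_inner \<alpha> f g - L"
      by (rule tendsto_eventually) (use ev in \<open>auto simp: eventually_sequentially\<close>)
    ultimately have "wL2_inner \<alpha> f g - L = 0" 
      using LIMSEQ_unique by blast
    then show ?thesis by simp
  qed
  have le1: "wL2_norm \<alpha> (\<lambda>t. fst U t - fst (fcomb \<alpha> c m) t) \<le> HH_norm \<alpha> (U - fcomb \<alpha> c m)"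
   and le2: "wL2_norm \<alpha> (\<lambda>t. snd U t - snd (fcomb \<alpha> c m) t) \<le> HH_norm \<alpha> (U - fcomb \<alpha> c m)" for m
    unfolding HH_norm_def by (rule real_le_rsqrt, simp add: fun_diff_def)+
  have "wL2_inner \<alpha> (fst U) (dual_trig \<alpha> n) = (c (2 * n - 1) + c (2 * n)) / sqrt 2"
  proof (rule *[OF U1 z F1 le1])
    fix m assume m: "m \<ge> 2 * n"
    have "wL2_inner \<alpha> (fst (fcomb \<alpha> c m)) (dual_trig \<alpha> n) =
          (\<Sum>j=1..m. c j / sqrt 2 * (if (j + 1) div 2 = n then 1 else 0))"
      unfolding fcomb_fst using n
      by (subst wL2_inner_sum_left) (use x z n biorth in \<open>auto intro!: sum.cong\<close>)
    then show "wL2_inner \<alpha> (fst (fcomb \<alpha> c m)) (dual_trig \<alpha> n) = (c (2 * n - 1) + c (2 * n)) / sqrt 2"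
      unfolding sum_over_pair[OF n m] by (simp add: add_divide_distrib)
  qed
  then show "c (2 * n - 1) + c (2 * n) = sqrt 2 * wL2_inner \<alpha> (fst U) (dual_trig \<alpha> n)" by simp
  have "wL2_inner \<alpha> (snd U) (trig n) = (c (2 * n - 1) - c (2 * n)) / sqrt 2"
  proof (rule *[OF U2 x F2 le2])
    fix m assume m: "m \<ge> 2 * n"
    have "wL2_inner \<alpha> (snd (fcomb \<alpha> c m)) (trig n) =
          (\<Sum>j=1..m. (if odd j then 1 else - 1) * c j / sqrt 2 * (if (j + 1) div 2 = n then 1 else 0))"
      unfolding fcomb_snd using n
      by (subst wL2_inner_sum_left) (use x z n biorth in \<open>auto intro!: sum.cong\<close>)
    then show "wL2_inner \<alpha> (snd (fcomb \<alpha> c m)) (trig n) = (c (2 * n - 1) - c (2 * n)) / sqrt 2"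
      unfolding sum_over_pair[OF n m] using n by (simp add: diff_divide_distrib)
  qed
  then show "c (2 * n - 1) - c (2 * n) = sqrt 2 * wL2_inner \<alpha> (snd U) (trig n)" by simp
qed

lemma fcoords_eqI:
  assumes \<alpha>: "0 < \<alpha>" "\<alpha> < 1" and U: "U \<in> HH \<alpha>" and "c 0 = 0"
    and lim: "(\<lambda>m. HH_norm \<alpha> (U - fcomb \<alpha> c m)) \<longlonglongrightarrow> 0"
  shows "fcoords \<alpha> U = c"
  unfolding fcoords_def
proof (rule the_equality)
  fix d assume d: "d 0 = 0 \<and> (\<lambda>m. HH_norm \<alpha> (U - fcomb \<alpha> d m)) \<longlonglongrightarrow> 0"
  show "d = c"
  proof
    fix j
    show "d j = c j"
    proof (cases "j = 0")
      case False
      define n where "n = (j + 1) div 2"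
      have n: "n \<ge> 1" "j = 2 * n - 1 \<or> j = 2 * n" using False unfolding n_def by presburger+
      then show ?thesis
        using HH_coords[OF \<alpha> U lim n(1)] HH_coords[OF \<alpha> U conjunct2[OF d] n(1)] by auto
    qed (use d assms in simp)
  qed
qed (use assms in simp)

text \<open>
  Biorthogonality forces the norms of \<open>x\<^sub>n\<close> and \<open>z\<^sub>n\<close> to have product at least 1, although
  \<open>x\<^sub>n\<close> itself may be short in the weighted norm.
\<close>

lemma HH_norm_fbasis_ge_1:
  assumes \<alpha>: "0 < \<alpha>" "\<alpha> < 1" and "j \<ge> 1"
  shows "1 \<le> (HH_norm \<alpha> (fbasis \<alpha> j))\<^sup>2"
proof -
  define n where "n = (j + 1) div 2"
  have n: "n \<ge> 1" using assms unfolding n_def by presburger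
  define X Z where "X = wL2_norm \<alpha> (trig n)" and "Z = wL2_norm \<alpha> (dual_trig \<alpha> n)"
  have "1 \<le> X * Z"
    using wL2_inner_Cauchy_Schwarz[OF trig_in_wL2[OF \<alpha>(1)] dual_trig_in_wL2[OF \<alpha>(2)], of n n]
    by (simp only: wL2_inner_trig_dual_trig[OF n n]) (simp add: X_def Z_def)
  also have "\<dots> \<le> (X\<^sup>2 + Z\<^sup>2) / 2"
    using sum_squares_bound[of X Z] by simp
  also have "\<dots> = (HH_norm \<alpha> (fbasis \<alpha> j))\<^sup>2"
    by (simp add: HH_norm_def fbasis_def Let_def n_def wL2_norm_power2 X_def Z_def
        power_divide power_mult_distrib if_distrib[of "\<lambda>x. x\<^sup>2"] add_divide_distrib cong: if_cong)
  finally show ?thesis .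
qed

lemma fproj_increment:
  "HH_norm \<alpha> (fproj \<alpha> (m + 1) U - fproj \<alpha> m U) = \<bar>fcoords \<alpha> U (m + 1)\<bar> * HH_norm \<alpha> (fbasis \<alpha> (m + 1))"
proof -
  have wL2_norm_scale: "wL2_norm \<alpha> (\<lambda>t. c * f t) = \<bar>c\<bar> * wL2_norm \<alpha> f" for c f
    by (simp add: wL2_norm_def power_mult_distrib real_sqrt_mult)
  have "fproj \<alpha> (m + 1) U - fproj \<alpha> m U =
      (\<lambda>t. fcoords \<alpha> U (m + 1) * fst (fbasis \<alpha> (m + 1)) t, \<lambda>t. fcoords \<alpha> U (m + 1) * snd (fbasis \<alpha> (m + 1)) t)"
    by (simp add: fproj_def fcomb_def fun_eq_iff)
  then show ?thesis
    by (simp add: HH_norm_def wL2_norm_scale power_mult_distrib distrib_left[symmetric] real_sqrt_mult)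
qed

section \<open>A cosine series dominated by an inverse square root\<close>

text \<open>
  Doubling the angle keeps the proof inside \<open>[0, \<pi>/4]\<close>, where the cosine is at least \<open>\<surd>2/2\<close>.
  The resulting constant is not sharp, but any bound linear in \<open>\<bar>t\<bar>\<close> serves to control the
  Dirichlet kernel.
\<close>

lemma abs_sin_pi_ge:
  fixes t :: real
  assumes "\<bar>t\<bar> \<le> 1/2"
  shows "\<bar>t\<bar> \<le> \<bar>sin (pi * t)\<bar>"
proof -
  have pos: "t \<le> sin (pi * t)" if t: "0 < t" "t \<le> 1/2" for t :: real
  proof -
    define y where "y = pi * t / 2"
    have y: "0 < y" "y \<le> pi / 4" using t by (auto simp: y_def)
    have cos_ge: "sqrt 2 / 2 \<le> cos x" if "0 \<le> x" "x \<le> y" for x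
      using cos_monotone_0_pi_le[of x "pi/4"] that y by (simp add: cos_45)
    obtain z where z: "0 < z" "z < y" "sin y - sin 0 = (y - 0) * cos z"
      using MVT2[of 0 y sin cos] y by auto
    have "t \<le> y"
      using t pi_gt3 mult_right_mono[of 2 pi t] by (simp add: y_def)
    also have "y = 2 * (y * (sqrt 2 / 2)) * (sqrt 2 / 2)" by simp
    also have "\<dots> \<le> 2 * (y * cos z) * cos y"
      using y z cos_ge[of z] cos_ge[of y] by (intro mult_mono mult_left_mono mult_nonneg_nonneg order_trans[OF _ cos_ge[of z]]) auto
    also have "\<dots> = sin (2 * y)" using z by (simp add: sin_double)
    finally show ?thesis by (simp add: y_def)
  qed
  consider "t = 0" | "t > 0" | "t < 0" by linarith
  then show ?thesis
    using pos[of t] pos[of "-t"] assms by cases auto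
qed

text \<open>
  The classical bound on the Dirichlet kernel: multiplying by \<open>2 sin (\<pi> t)\<close> makes the sum
  telescope.
\<close>

lemma cos_sum_bound:
  fixes t :: real
  assumes "t \<noteq> 0" "\<bar>t\<bar> \<le> 1/2" "1 \<le> m" "m \<le> n"
  shows "\<bar>\<Sum>k=m..n. cos (2 * pi * real k * t)\<bar> \<le> 1 / \<bar>t\<bar>"
proof -
  have telescope: "2 * sin (pi * t) * (\<Sum>k=m..n. cos (2 * pi * real k * t)) =
        sin ((2 * real n + 1) * (pi * t)) - sin ((2 * real m - 1) * (pi * t))"
    using \<open>m \<le> n\<close>
  proof (induction n rule: dec_induct)
    case base
    have "sin ((2 * real m + 1) * (pi * t)) - sin ((2 * real m - 1) * (pi * t)) =
          sin (2 * real m * (pi * t) + pi * t) - sin (2 * real m * (pi * t) - pi * t)"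
      by (simp add: algebra_simps)
    also have "\<dots> = 2 * sin (pi * t) * cos (2 * real m * (pi * t))"
      by (simp add: sin_add sin_diff)
    finally show ?case by (simp add: mult_ac)
  next
    case (step n)
    define x where "x = 2 * real (Suc n) * (pi * t)"
    have "2 * sin (pi * t) * cos x = sin (x + pi * t) - sin (x - pi * t)"
      by (simp add: sin_add sin_diff)
    also have "x + pi * t = (2 * real (Suc n) + 1) * (pi * t)" by (simp add: x_def algebra_simps)
    also have "x - pi * t = (2 * real n + 1) * (pi * t)" by (simp add: x_def algebra_simps)
    also have "cos x = cos (2 * pi * real (Suc n) * t)" by (simp add: x_def mult_ac)
    finally show ?case using step by (simp add: distrib_left del: of_nat_Suc)
  qed
  have "2 * (\<bar>sin (pi * t)\<bar> * \<bar>\<Sum>k=m..n. cos (2 * pi * real k * t)\<bar>) =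
        \<bar>2 * sin (pi * t) * (\<Sum>k=m..n. cos (2 * pi * real k * t))\<bar>"
    by (simp only: abs_mult abs_numeral mult.assoc)
  also have "\<dots> = \<bar>sin ((2 * real n + 1) * (pi * t)) - sin ((2 * real m - 1) * (pi * t))\<bar>"
    by (simp only: telescope)
  also have "\<dots> \<le> 2"
    using abs_sin_le_one[of "(2 * real n + 1) * (pi * t)"] abs_sin_le_one[of "(2 * real m - 1) * (pi * t)"]
    by linarith
  finally have "\<bar>sin (pi * t)\<bar> * \<bar>\<Sum>k=m..n. cos (2 * pi * real k * t)\<bar> \<le> 1" by simp
  moreover have "\<bar>t\<bar> * \<bar>\<Sum>k=m..n. cos (2 * pi * real k * t)\<bar> \<le>
                 \<bar>sin (pi * t)\<bar> * \<bar>\<Sum>k=m..n. cos (2 * pi * real k * t)\<bar>"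
    by (intro mult_right_mono abs_sin_pi_ge assms) auto
  ultimately show ?thesis using assms(1) by (simp add: pos_le_divide_eq mult.commute)
qed

lemma Abel_summation_bound:
  fixes a b :: "nat \<Rightarrow> real"
  assumes dec: "\<And>k. m \<le> k \<Longrightarrow> a (Suc k) \<le> a k" and nonneg: "\<And>k. m \<le> k \<Longrightarrow> 0 \<le> a k"
    and bound: "\<And>n. m \<le> n \<Longrightarrow> \<bar>\<Sum>k=m..n. b k\<bar> \<le> B" and "m \<le> n"
  shows "\<bar>\<Sum>k=m..n. a k * b k\<bar> \<le> B * a m"
proof -
  \<comment> \<open>Removing the boundary term of summation by parts gives a bound that telescopes in \<open>n\<close>.\<close>
  have "\<bar>(\<Sum>k=m..n. a k * b k) - a n * (\<Sum>k=m..n. b k)\<bar> \<le> B * (a m - a n)"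
    using \<open>m \<le> n\<close>
  proof (induction n rule: dec_induct)
    case (step n)
    have "(\<Sum>k=m..Suc n. a k * b k) - a (Suc n) * (\<Sum>k=m..Suc n. b k) =
       ((\<Sum>k=m..n. a k * b k) - a n * (\<Sum>k=m..n. b k)) + (a n - a (Suc n)) * (\<Sum>k=m..n. b k)"
      using step by (simp add: algebra_simps)
    also have "\<bar>\<dots>\<bar> \<le> B * (a m - a n) + (a n - a (Suc n)) * B"
    proof (rule order_trans[OF abs_triangle_ineq add_mono[OF step.IH]])
      show "\<bar>(a n - a (Suc n)) * (\<Sum>k=m..n. b k)\<bar> \<le> (a n - a (Suc n)) * B"
        unfolding abs_mult using dec[of n] bound[of n] step by (intro mult_mono) auto
    qed
    finally show ?case by (simp add: algebra_simps)
  qed simp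
  moreover have "\<bar>a n * (\<Sum>k=m..n. b k)\<bar> \<le> a n * B"
    unfolding abs_mult using nonneg[of n] bound[of n] \<open>m \<le> n\<close> by (intro mult_mono) auto
  ultimately show ?thesis by (simp add: algebra_simps)
qed

definition cos_sum :: "nat \<Rightarrow> real \<Rightarrow> real" where
  "cos_sum n t = (\<Sum>k=1..n. 1 / sqrt (real k) * cos (2 * pi * real k * t))"

lemma cos_sum_measurable [measurable]: "cos_sum n \<in> borel_measurable borel"
  unfolding cos_sum_def by measurable

lemma cos_sum_diff_le:
  assumes "t \<noteq> 0" "\<bar>t\<bar> \<le> 1/2" "m \<le> n"
  shows "\<bar>cos_sum n t - cos_sum m t\<bar> \<le> 1 / \<bar>t\<bar> * (1 / sqrt (real (Suc m)))"
proof (cases "m = n")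
  case False
  then have "m < n" using assms by simp
  have "cos_sum n t - cos_sum m t = (\<Sum>k=Suc m..n. 1 / sqrt (real k) * cos (2 * pi * real k * t))"
    using sum.ub_add_nat[of 1 m "\<lambda>k. 1 / sqrt (real k) * cos (2 * pi * real k * t)" "n - m"] \<open>m < n\<close>
    by (simp add: cos_sum_def)
  also have "\<bar>\<dots>\<bar> \<le> 1 / \<bar>t\<bar> * (1 / sqrt (real (Suc m)))"
  proof (rule Abel_summation_bound)
    show "1 / sqrt (real (Suc k)) \<le> 1 / sqrt (real k)" if "Suc m \<le> k" for k
      using that by (intro frac_le) auto
    show "\<bar>\<Sum>k=Suc m..n. cos (2 * pi * real k * t)\<bar> \<le> 1 / \<bar>t\<bar>" if "Suc m \<le> n" for n
      using that assms by (intro cos_sum_bound) auto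
  qed (use \<open>m < n\<close> in auto)
  finally show ?thesis .
qed simp

lemma sum_inverse_sqrt_le: "(\<Sum>k=1..n. 1 / sqrt (real k)) \<le> 2 * sqrt (real n)"
proof (induction n)
  case (Suc n)
  define x y where "x = sqrt (real n)" and "y = sqrt (real (Suc n))"
  have xy: "0 \<le> x" "0 < y" "y\<^sup>2 = x\<^sup>2 + 1" by (auto simp: x_def y_def)
  have "0 \<le> (y - x)\<^sup>2" by simp
  then have "1 / y \<le> 2 * y - 2 * x"
    using xy by (simp add: field_simps power2_eq_square)
  with Suc show ?case by (simp add: x_def y_def del: of_nat_Suc)
qed simp

text \<open>
  The sum is split at \<open>K \<approx> 1/\<bar>t\<bar>\<close>.  Up to \<open>K\<close> the terms hardly oscillate and are estimated by
  absolute values, which gives \<open>2 \<surd>K\<close>; beyond \<open>K\<close> Abel summation gives \<open>1 / (\<bar>t\<bar> \<surd>K)\<close>.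
  Both have the order \<open>\<bar>t\<bar>\<^sup>-\<^sup>1\<^sup>/\<^sup>2\<close>.
\<close>

lemma cos_sum_dominated:
  assumes "t \<noteq> 0" "\<bar>t\<bar> \<le> 1/2"
  shows "\<bar>cos_sum n t\<bar> \<le> 3 * \<bar>t\<bar> powr (-1/2)"
proof -
  define K where "K = nat \<lfloor>1 / \<bar>t\<bar>\<rfloor>"
  have "0 \<le> 1 / \<bar>t\<bar>" by simp
  then have K: "real K = of_int \<lfloor>1 / \<bar>t\<bar>\<rfloor>" by (simp add: K_def)
  have K1: "real K \<le> 1 / \<bar>t\<bar>" and K2: "1 / \<bar>t\<bar> \<le> real (Suc K)"
    using of_int_floor_le[of "1 / \<bar>t\<bar>"] real_of_int_floor_add_one_ge[of "1 / \<bar>t\<bar>"] K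
    by linarith+
  have low: "\<bar>cos_sum i t\<bar> \<le> 2 / sqrt \<bar>t\<bar>" if "i \<le> K" for i
  proof -
    have "\<bar>cos_sum i t\<bar> \<le> (\<Sum>k=1..i. \<bar>1 / sqrt (real k) * cos (2 * pi * real k * t)\<bar>)"
      unfolding cos_sum_def by (rule sum_abs)
    also have "\<dots> \<le> (\<Sum>k=1..i. 1 / sqrt (real k))"
      by (intro sum_mono) (simp add: abs_mult divide_right_mono)
    also have "\<dots> \<le> 2 * sqrt (real i)" by (rule sum_inverse_sqrt_le)
    also have "\<dots> \<le> 2 * sqrt (1 / \<bar>t\<bar>)" using that K1 by simp
    finally show ?thesis by (simp add: real_sqrt_divide)
  qed
  have "\<bar>cos_sum n t\<bar> \<le> 3 / sqrt \<bar>t\<bar>"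
  proof (cases "n \<le> K")
    case True
    from low[OF this] show ?thesis using assms by (auto intro: order.trans divide_right_mono)
  next
    case False
    have "\<bar>cos_sum n t - cos_sum K t\<bar> \<le> 1 / \<bar>t\<bar> * (1 / sqrt (real (Suc K)))"
      using False assms by (intro cos_sum_diff_le) auto
    also have "\<dots> \<le> 1 / \<bar>t\<bar> * (1 / sqrt (1 / \<bar>t\<bar>))"
      using assms K2 by (intro mult_left_mono divide_left_mono real_sqrt_le_mono) (auto simp del: of_nat_Suc)
    also have "\<dots> = 1 / sqrt \<bar>t\<bar>"
      using assms by (simp add: real_sqrt_divide field_simps)
    finally show ?thesis using low[of K] by (simp add: field_simps)
  qed
  moreover have "\<bar>t\<bar> powr (-1/2) = 1 / sqrt \<bar>t\<bar>"
    using powr_minus_divide[of "\<bar>t\<bar>" "1/2"] powr_half_sqrt[of "\<bar>t\<bar>"] by simp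
  ultimately show ?thesis by (simp only: times_divide_eq_right mult_1_right)
qed

lemma cos_sum_convergent:
  assumes "t \<noteq> 0" "\<bar>t\<bar> \<le> 1/2"
  shows "convergent (\<lambda>n. cos_sum n t)"
proof -
  have "Cauchy (\<lambda>n. cos_sum n t)"
  proof (rule CauchyI')
    fix e :: real assume "0 < e"
    have "(\<lambda>m. 1 / \<bar>t\<bar> * (1 / sqrt (real (Suc m)))) \<longlonglongrightarrow> 1 / \<bar>t\<bar> * 0"
      using tendsto_real_sqrt[OF LIMSEQ_inverse_real_of_nat]
      by (intro tendsto_mult_left) (simp add: real_sqrt_divide inverse_eq_divide del: of_nat_Suc)
    from order_tendstoD(2)[OF this, of e] \<open>0 < e\<close> obtain M where
      M: "\<And>m. m \<ge> M \<Longrightarrow> 1 / \<bar>t\<bar> * (1 / sqrt (real (Suc m))) < e"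
      by (auto simp: eventually_sequentially)
    show "\<exists>M. \<forall>m\<ge>M. \<forall>n>m. dist (cos_sum m t) (cos_sum n t) < e"
    proof (intro exI[of _ M] allI impI)
      fix m n assume "M \<le> m" "m < n"
      then have "\<bar>cos_sum n t - cos_sum m t\<bar> < e"
        using cos_sum_diff_le[OF assms, of m n] M[of m] by linarith
      then show "dist (cos_sum m t) (cos_sum n t) < e" by (simp add: dist_real_def abs_minus_commute)
    qed
  qed
  then show ?thesis by (rule Cauchy_convergent)
qed

section \<open>An element with divergent increments\<close>

definition witness_fun :: "real \<Rightarrow> real" where
  "witness_fun t = lim (\<lambda>n. cos_sum n t)"

text \<open>
  Only even \<open>n = 2k\<close> carry a cosine, and there the value is \<open>1 / (2 \<surd>k)\<close>: the normalising
  factors \<open>\<surd>2\<close> and \<open>1/\<surd>2\<close> of the systems cancel, and the two equal coefficients of \<open>n\<close> add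
  up to \<open>1 / \<surd>k\<close>.  At \<open>j = 0\<close> division by zero yields the value 0 that the normalisation of
  coordinates requires.
\<close>

definition witness_coeff :: "nat \<Rightarrow> real" where
  "witness_coeff j =
    (let n = (j + 1) div 2 in if even n then 1 / sqrt (2 * real n) else 0)"

abbreviation witness :: fpair where
  "witness \<equiv> (witness_fun, \<lambda>_. 0)"

lemma witness_fun_measurable [measurable]: "witness_fun \<in> borel_measurable borel"
  unfolding witness_fun_def by measurable

lemma cos_sum_tendsto:
  assumes "t \<noteq> 0" "\<bar>t\<bar> \<le> 1/2"
  shows "(\<lambda>n. cos_sum n t) \<longlonglongrightarrow> witness_fun t"
  using cos_sum_convergent[OF assms] by (simp add: witness_fun_def convergent_LIMSEQ_iff)

lemma witness_fun_dominated:
  assumes "t \<noteq> 0" "\<bar>t\<bar> \<le> 1/2"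
  shows "\<bar>witness_fun t\<bar> \<le> 3 * \<bar>t\<bar> powr (-1/2)"
  using cos_sum_tendsto[OF assms] cos_sum_dominated[OF assms]
  by (intro Lim_bounded[OF tendsto_rabs]) auto

lemma witness_in_HH:
  assumes "0 < \<alpha>" shows "witness \<in> HH \<alpha>"
proof -
  have "witness_fun \<in> wL2 \<alpha>"
    by (rule wL2_bound[where p = "-1/2" and C = 3]) (use assms witness_fun_dominated in auto)
  then show ?thesis by (simp add: HH_def wL2_def)
qed

lemma div_4_eq: "n div 4 = n div 2 div 2" for n :: nat
  using div_mult2_eq[of n 2 2] by simp

lemma witness_coeff_trig:
  "witness_coeff (Suc m) / sqrt 2 * trig ((m + 2) div 2) t =
    (cos_sum ((m + 2) div 4) t - cos_sum (m div 4) t) / 2"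
proof (cases "odd (m div 2)")
  case True
  then obtain i where i: "m div 2 = 2 * i + 1" by (elim oddE)
  obtain k where k: "k = Suc i" by simp
  have n: "(m + 2) div 2 = 2 * k" using i k by simp
  have *: "(m + 2) div 4 = k" "m div 4 = i" unfolding div_4_eq n i by simp_all
  have "(Suc m + 1) div 2 = 2 * k" using n by simp
  then have c: "witness_coeff (Suc m) = 1 / (2 * sqrt (real k))"
    using real_sqrt_mult[of 4 "real k"] by (simp add: witness_coeff_def Let_def)
  have "trig (2 * k) t = sqrt 2 * cos (2 * pi * real k * t)"
    by (simp add: trig_def)
  moreover have "cos_sum k t - cos_sum i t = 1 / sqrt (real k) * cos (2 * pi * real k * t)"
    by (simp add: cos_sum_def k del: of_nat_Suc)
  ultimately show ?thesis unfolding c n * by simp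
next
  case False
  then obtain i where i: "m div 2 = 2 * i" by auto
  have n: "(m + 2) div 2 = 2 * i + 1" using i by simp
  have "(m + 2) div 4 = m div 4" unfolding div_4_eq n i by simp
  moreover have "witness_coeff (Suc m) = 0" using n by (simp add: witness_coeff_def Let_def)
  ultimately show ?thesis by simp
qed

text \<open>
  A truncation after the first of two paired indices contains only half of the last cosine,
  hence the average of two consecutive cosine sums.
\<close>

lemma fst_fcomb_witness:
  "fst (fcomb \<alpha> witness_coeff m) t = (cos_sum (m div 4) t + cos_sum ((m + 1) div 4) t) / 2"
proof (induction m)
  case 0
  then show ?case by (simp add: fcomb_fst cos_sum_def)
next
  case (Suc m)
  have "fst (fcomb \<alpha> witness_coeff (Suc m)) t = fst (fcomb \<alpha> witness_coeff m) t +
          witness_coeff (Suc m) / sqrt 2 * trig ((m + 2) div 2) t"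
    by (simp add: fcomb_fst)
  also have "\<dots> = (cos_sum (m div 4) t + cos_sum ((m + 1) div 4) t) / 2 +
        (cos_sum ((m + 2) div 4) t - cos_sum (m div 4) t) / 2"
    by (simp only: witness_coeff_trig Suc)
  finally show ?case by (simp add: field_simps)
qed

text \<open>
  The second components of paired basis elements cancel, so only an unpaired last term remains.
\<close>

lemma snd_fcomb_witness:
  "snd (fcomb \<alpha> witness_coeff m) t =
     (cos_sum ((m + 1) div 4) t - cos_sum (m div 4) t) / 2 / \<bar>t\<bar> powr \<alpha>"
proof (induction m)
  case 0
  then show ?case by (simp add: fcomb_snd cos_sum_def)
next
  case (Suc m)
  define \<sigma> :: real where "\<sigma> = (if odd (Suc m) then 1 else - 1)"
  define A B C where "A = cos_sum (m div 4) t" and "B = cos_sum ((m + 1) div 4) t"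
    and "C = cos_sum ((m + 2) div 4) t"
  have "snd (fcomb \<alpha> witness_coeff (Suc m)) t = snd (fcomb \<alpha> witness_coeff m) t +
          \<sigma> * (witness_coeff (Suc m) / sqrt 2 * trig ((m + 2) div 2) t) / \<bar>t\<bar> powr \<alpha>"
    by (simp add: fcomb_snd dual_trig_def \<sigma>_def)
  also have "\<dots> = (B - A) / 2 / \<bar>t\<bar> powr \<alpha> + \<sigma> * ((C - A) / 2) / \<bar>t\<bar> powr \<alpha>"
    by (simp only: witness_coeff_trig Suc A_def B_def C_def)
  also have "\<dots> = ((B - A) + \<sigma> * (C - A)) / 2 / \<bar>t\<bar> powr \<alpha>"
    by (simp add: add_divide_distrib)
  also have "(B - A) + \<sigma> * (C - A) = C - B"
  proof (cases "even m")
    case True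
    then have "(m + 1) div 4 = m div 4" by (simp add: div_4_eq)
    then show ?thesis using True by (simp add: A_def B_def \<sigma>_def)
  next
    case False
    then have "(m + 2) div 4 = (m + 1) div 4" by (simp add: div_4_eq)
    then show ?thesis using False by (simp add: C_def B_def \<sigma>_def)
  qed
  finally show ?case by (simp add: C_def B_def)
qed

lemma filterlim_div_4: "filterlim (\<lambda>m::nat. (m + i) div 4) sequentially sequentially"
  unfolding filterlim_at_top eventually_sequentially
proof (intro allI)
  fix Z :: nat
  have "Z \<le> (m + i) div 4" if "4 * Z \<le> m" for m
    using that by (simp add: less_eq_div_iff_mult_less_eq)
  then show "\<exists>N. \<forall>m\<ge>N. Z \<le> (m + i) div 4" by blast
qed

text \<open>
  The first component needs the exponent \<open>-1/2\<close> and thus \<open>0 < \<alpha>\<close>; the second is at most a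
  single term \<open>z\<^sub>n\<close> with a bounded coefficient, which needs the exponent \<open>-\<alpha>\<close> and thus
  \<open>\<alpha> < 1\<close>.
\<close>

lemma witness_expansion:
  assumes \<alpha>: "0 < \<alpha>" "\<alpha> < 1"
  shows "(\<lambda>m. HH_norm \<alpha> (witness - fcomb \<alpha> witness_coeff m)) \<longlonglongrightarrow> 0"
proof -
  let ?f = "\<lambda>m. fst (fcomb \<alpha> witness_coeff m)" and ?g = "\<lambda>m. snd (fcomb \<alpha> witness_coeff m)"
  have sub: "(\<lambda>m. cos_sum ((m + i) div 4) t) \<longlonglongrightarrow> witness_fun t" if "t \<noteq> 0" "\<bar>t\<bar> \<le> 1/2" for t i
    by (rule filterlim_compose[OF cos_sum_tendsto[OF that] filterlim_div_4])
  have f_meas: "?f m \<in> borel_measurable borel" and g_meas: "?g m \<in> borel_measurable borel" for m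
    unfolding fcomb_fst fcomb_snd by measurable
  have lim1: "(\<lambda>m. wL2_norm \<alpha> (\<lambda>t. witness_fun t - ?f m t)) \<longlonglongrightarrow> 0"
  proof (rule wL2_norm_dominated[where p = "-1/2" and C = 6])
    fix t :: real assume t: "t \<noteq> 0" "\<bar>t\<bar> \<le> 1/2"
    have "\<bar>w - (a + b) / 2\<bar> \<le> 6 * r" if "\<bar>w\<bar> \<le> 3 * r" "\<bar>a\<bar> \<le> 3 * r" "\<bar>b\<bar> \<le> 3 * r"
      for w a b r :: real
      using that unfolding abs_le_iff by (simp add: field_simps)
    then show "\<bar>witness_fun t - ?f m t\<bar> \<le> 6 * \<bar>t\<bar> powr (-1/2)" for m
      unfolding fst_fcomb_witness using witness_fun_dominated[OF t] cos_sum_dominated[OF t] by blast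
    have "(\<lambda>m. ?f m t) \<longlonglongrightarrow> (witness_fun t + witness_fun t) / 2"
      unfolding fst_fcomb_witness using sub[OF t, of 0] sub[OF t, of 1]
      by (intro tendsto_intros) auto
    then show "(\<lambda>m. ?f m t) \<longlonglongrightarrow> witness_fun t" by simp
  qed (use \<alpha> f_meas in auto)
  have step: "\<bar>cos_sum ((m + 1) div 4) t - cos_sum (m div 4) t\<bar> \<le> 1" for m t
  proof (cases "(m + 1) div 4 = m div 4")
    case False
    then have *: "(m + 1) div 4 = Suc (m div 4)" by (simp add: div_Suc split: if_splits)
    have "\<bar>cos_sum ((m + 1) div 4) t - cos_sum (m div 4) t\<bar> =
          1 / sqrt (real (Suc (m div 4))) * \<bar>cos (2 * pi * real (Suc (m div 4)) * t)\<bar>"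
      unfolding * cos_sum_def by (simp add: abs_mult del: of_nat_Suc)
    also have "\<dots> \<le> 1 * 1" by (intro mult_mono) (auto simp del: of_nat_Suc)
    finally show ?thesis by simp
  qed simp
  have lim2: "(\<lambda>m. wL2_norm \<alpha> (\<lambda>t. 0 - ?g m t)) \<longlonglongrightarrow> 0"
  proof (rule wL2_norm_dominated[where p = "-\<alpha>" and C = "1/2"])
    fix t :: real assume t: "t \<noteq> 0" "\<bar>t\<bar> \<le> 1/2"
    show "\<bar>0 - ?g m t\<bar> \<le> 1/2 * \<bar>t\<bar> powr (-\<alpha>)" for m
    proof -
      have "\<bar>0 - ?g m t\<bar> = \<bar>cos_sum ((m + 1) div 4) t - cos_sum (m div 4) t\<bar> / 2 / \<bar>t\<bar> powr \<alpha>"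
        unfolding snd_fcomb_witness diff_0 abs_minus_cancel abs_divide by simp
      also have "\<dots> \<le> 1 / 2 / \<bar>t\<bar> powr \<alpha>"
        by (intro divide_right_mono step) auto
      finally show ?thesis by (simp only: powr_minus_divide times_divide_eq_right mult_1_right)
    qed
    have "(\<lambda>m. ?g m t) \<longlonglongrightarrow> (witness_fun t - witness_fun t) / 2 / \<bar>t\<bar> powr \<alpha>"
      unfolding snd_fcomb_witness using sub[OF t, of 0] sub[OF t, of 1] t
      by (intro tendsto_divide tendsto_diff tendsto_const) simp_all
    then show "(\<lambda>m. ?g m t) \<longlonglongrightarrow> 0" by simp
  qed (use \<alpha> g_meas in auto)
  have "(\<lambda>m. sqrt ((wL2_norm \<alpha> (\<lambda>t. witness_fun t - ?f m t))\<^sup>2 + (wL2_norm \<alpha> (\<lambda>t. 0 - ?g m t))\<^sup>2))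
          \<longlonglongrightarrow> sqrt (0\<^sup>2 + 0\<^sup>2)"
    by (intro tendsto_intros lim1 lim2)
  then show ?thesis by (simp add: HH_norm_def fun_diff_def)
qed

text \<open>
  One increment in each block of four, the one with index \<open>j = 4k\<close>, already contributes
  \<open>1 / (4k)\<close>.
\<close>

lemma witness_increments_ge:
  assumes \<alpha>: "0 < \<alpha>" "\<alpha> < 1"
  shows "harm n / 4 \<le> (\<Sum>m<4 * n. (HH_norm \<alpha> (fproj \<alpha> (m + 1) witness - fproj \<alpha> m witness))\<^sup>2)"
proof -
  let ?D = "\<lambda>m. (HH_norm \<alpha> (fproj \<alpha> (m + 1) witness - fproj \<alpha> m witness))\<^sup>2"
  have coords: "fcoords \<alpha> witness = witness_coeff"
    by (rule fcoords_eqI[OF \<alpha> witness_in_HH[OF \<alpha>(1)] _ witness_expansion[OF \<alpha>]])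
       (simp add: witness_coeff_def)
  have D_ge: "(witness_coeff (m + 1))\<^sup>2 \<le> ?D m" for m
    unfolding fproj_increment coords power_mult_distrib
    using mult_left_mono[OF HH_norm_fbasis_ge_1[OF \<alpha>, of "m + 1"], of "(witness_coeff (m + 1))\<^sup>2"] by simp
  show ?thesis
  proof (induction n)
    case (Suc n)
    have "4 * Suc n = Suc (Suc (Suc (Suc (4 * n))))" by simp
    then have "(\<Sum>m<4 * Suc n. ?D m) = (\<Sum>m<4 * n. ?D m) + ?D (4 * n) + ?D (4 * n + 1) + ?D (4 * n + 2) + ?D (4 * n + 3)"
      by (simp only: sum.lessThan_Suc) (simp add: numeral_eq_Suc)
    moreover have "?D (4 * n) \<ge> 0" "?D (4 * n + 1) \<ge> 0" "?D (4 * n + 2) \<ge> 0" by simp_all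
    moreover have "?D (4 * n + 3) \<ge> inverse (real (Suc n)) / 4"
    proof -
      obtain k where k: "k = Suc n" by simp
      then have "(4 * n + 3 + 1 + 1) div 2 = 2 * k" by simp
      then have "(witness_coeff (4 * n + 3 + 1))\<^sup>2 = inverse (real (Suc n)) / 4"
        unfolding k[symmetric]
        by (simp add: witness_coeff_def Let_def power_divide inverse_eq_divide)
      then show ?thesis using D_ge[of "4 * n + 3"] by simp
    qed
    ultimately show ?case using Suc by (simp only: harm_Suc add_divide_distrib)
  qed (simp add: harm_def)
qed

text \<open>
  The denominator of the quasi-orthogonality quotient must not vanish: a null element would have
  vanishing coordinates by Cauchy-Schwarz, but those of \<open>cos (2 \<pi> t)\<close> are positive.
\<close>

lemma witness_norm_nonzero:
  assumes \<alpha>: "0 < \<alpha>" "\<alpha> < 1"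
  shows "HH_norm \<alpha> witness \<noteq> 0"
proof
  assume "HH_norm \<alpha> witness = 0"
  then have norm0: "wL2_norm \<alpha> witness_fun = 0"
    by (simp add: HH_norm_def add_nonneg_eq_0_iff)
  have "sqrt 2 * wL2_inner \<alpha> witness_fun (dual_trig \<alpha> 2) = witness_coeff 3 + witness_coeff 4"
    using HH_coords(1)[OF \<alpha> witness_in_HH[OF \<alpha>(1)] witness_expansion[OF \<alpha>], of 2] by simp
  also have "\<dots> > 0" by (simp add: witness_coeff_def)
  finally have "wL2_inner \<alpha> witness_fun (dual_trig \<alpha> 2) \<noteq> 0" by auto
  moreover have "\<bar>wL2_inner \<alpha> witness_fun (dual_trig \<alpha> 2)\<bar> \<le> 0"
    using wL2_inner_Cauchy_Schwarz[of witness_fun \<alpha> "dual_trig \<alpha> 2"] witness_in_HH[OF \<alpha>(1)]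
      dual_trig_in_wL2[OF \<alpha>(2)] norm0 by (simp add: HH_def)
  ultimately show False by simp
qed

lemma ennreal_eq_top_if_unbounded:
  fixes x :: ennreal
  assumes "\<And>n::nat. of_nat n \<le> x"
  shows "x = \<infinity>"
  using ennreal_Ex_less_of_nat[of x] assms by (force simp: less_top[symmetric] not_less[symmetric])

theorem theorem6p3:
  fixes \<alpha> :: real
  assumes "0 < \<alpha>" and "\<alpha> < 1"
  shows "(\<exists>U \<in> HH \<alpha>.
            (\<Sum>m. ennreal ((HH_norm \<alpha> (fproj \<alpha> (m + 1) U - fproj \<alpha> m U))\<^sup>2)) = \<infinity>)
         \<and> full_quasi_orth_const \<alpha> = \<infinity>"
proof
  let ?D = "\<lambda>m. (HH_norm \<alpha> (fproj \<alpha> (m + 1) witness - fproj \<alpha> m witness))\<^sup>2"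
  have W: "witness \<in> HH \<alpha>" by (rule witness_in_HH[OF assms(1)])
  have unbounded: "\<exists>N\<ge>1. r \<le> (\<Sum>m<N. ?D m)" for r
  proof -
    have "\<forall>\<^sub>F n in sequentially. 4 * r \<le> harm n \<and> n \<ge> 1"
      using harm_at_top by (intro eventually_conj eventually_ge_at_top) (auto simp: filterlim_at_top)
    then obtain n where "4 * r \<le> harm n" "n \<ge> 1" by (auto simp: eventually_sequentially)
    then show ?thesis
      using witness_increments_ge[OF assms, of n] by (intro exI[of _ "4 * n"]) auto
  qed
  have "(\<Sum>m. ennreal (?D m)) = \<infinity>"
  proof (rule ennreal_eq_top_if_unbounded)
    fix n :: nat
    obtain N where "real n \<le> (\<Sum>m<N. ?D m)" using unbounded by blast
    then have "of_nat n \<le> (\<Sum>m<N. ennreal (?D m))"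
      by (simp add: ennreal_of_nat_eq_real_of_nat ennreal_leI)
    also have "\<dots> \<le> (\<Sum>m. ennreal (?D m))" by (rule sum_le_suminf) auto
    finally show "of_nat n \<le> (\<Sum>m. ennreal (?D m))" .
  qed
  then show "\<exists>U \<in> HH \<alpha>. (\<Sum>m. ennreal ((HH_norm \<alpha> (fproj \<alpha> (m + 1) U - fproj \<alpha> m U))\<^sup>2)) = \<infinity>"
    using W by blast
  define q where "q = (HH_norm \<alpha> witness)\<^sup>2"
  have q: "q > 0" using witness_norm_nonzero[OF assms] by (simp add: q_def)
  have "fproj \<alpha> 0 witness = (\<lambda>_. 0, \<lambda>_. 0)" by (simp add: fproj_def fcomb_def)
  then have residual: "witness - fproj \<alpha> 0 witness = witness" by (simp add: fun_diff_def)
  show "full_quasi_orth_const \<alpha> = \<infinity>"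
  proof (rule ennreal_eq_top_if_unbounded)
    fix n :: nat
    obtain N where N: "N \<ge> 1" "real n * q \<le> (\<Sum>m<N. ?D m)" using unbounded by blast
    then have "real n \<le> (\<Sum>m<N. ?D m) / q" using q by (simp add: pos_le_divide_eq)
    then have "of_nat n \<le> ennreal ((\<Sum>m<N. ?D m) / q)"
      by (simp add: ennreal_of_nat_eq_real_of_nat ennreal_leI)
    also have "\<dots> = ennreal ((\<Sum>k=0..<0 + N. (HH_norm \<alpha> (fproj \<alpha> (k + 1) witness - fproj \<alpha> k witness))\<^sup>2)
                / (HH_norm \<alpha> (witness - fproj \<alpha> 0 witness))\<^sup>2)"
      by (simp only: residual q_def add_0 atLeast0LessThan)
    also have "\<dots> \<le> quasi_orth_const \<alpha> N"
      unfolding quasi_orth_const_def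
      by (intro SUP_upper2[where i = 0] SUP_upper) (use W witness_norm_nonzero[OF assms] residual in auto)
    also have "\<dots> \<le> full_quasi_orth_const \<alpha>"
      unfolding full_quasi_orth_const_def using N by (intro SUP_upper) auto
    finally show "of_nat n \<le> full_quasi_orth_const \<alpha>" .
  qed
qed

end
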